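(* Let $g\in\mathbb{R}^n\setminus\{0\}$, let $H$ be a real symmetric $n\times n$ matrix, and let $\rho:\mathbb{R}\to[0,\infty]$ be a proper closed convex function with $\rho(0)=0$. Suppose that: (1) $\rho$ is nondecreasing, $\rho(t)=0$ for all $t\le 0$, and there exists $t_0>0$ with $\rho(t_0)<\infty$; (2) $\lim_{t\to\infty}\rho(t)/t=\infty$; (3) the monotone conjugate $\rho^+$ is differentiable at every $t>0$. For $t\in\mathbb{R}$ let $$\lambda(t):=\lambda_{\min}\left(\begin{bmatrix}t&g^T\\ g&H\end{bmatrix}\right),\qquad \widehat k(t):=\inf_{\gamma\ge 0}\{\rho(\gamma-1)+\gamma\lambda(t)\},$$ let $\bar t:=\lim_{\lambda\uparrow\lambda_{\min}(H)}[\lambda+g^T(H-\lambda I)^{-1}g]\in(-\infty,\infty]$, and let $t^*$ be a maximizer of $\sup_{t\in\mathbb{R}}\{\widehat k(t)-t\}$. Then $\lambda(t^* )\le 0$. Suppose in addition that $\widehat k$ is differentiable at $t^*$. Then $\lambda(t^* )<0$, and for any unit eigenvector $\begin{bmatrix}v_0&\bar v^T\end{bmatrix}^T\in\mathbb{R}^{n+1}$ (with $v_0\in\mathbb{R}$) of $\begin{bmatrix}t^*&g^T\\ g&H\end{bmatrix}$ corresponding to $\lambda(t^* )$, it holds that $v_0\ne 0$ and $x^*:=\frac{1}{v_0}\bar v$ is a global minimizer of $$\inf_{x\in\mathbb{R}^n}\ 2g^Tx+x^THx+\rho(\|x\|^2).$$ Furthermore, the quantities $$\tau:=\sup\{\alpha\ge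 0:\ \rho(\alpha^2)\le 2\max\{2\|g\|\alpha,\|H\|\alpha^2\}\},$$ $$\kappa:=\sup\Big(\{0\}\cup\big\{\beta>\max\{\lambda_{\min}(H),0\}:\ \beta\sqrt{(\rho^+)'(\beta-\lambda_{\min}(H))}\le\|g\|\big\}\Big)$$ are finite, and $$\lambda_{\min}(H)-\zeta\le t^*\le\min\{\bar t,\ \lambda_{\min}(H)+\eta\|g\|\}$$ for any $\eta\ge\tau$ and any $\zeta\ge\kappa$.
   Context: $\|x\|$ is the Euclidean norm of a vector and $\|H\|$ the spectral norm of a matrix; $\lambda_{\min}(A)$ is the smallest eigenvalue of a real symmetric matrix $A$; $I$ is the identity matrix. The monotone conjugate of $\rho$ is $\rho^+(u):=\sup_{t\ge 0}\{ut-\rho(t)\}$. *)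

theory Defs
  imports "HOL-Analysis.Analysis"
begin

definition eigenpair :: "real^'n^'n \<Rightarrow> real \<Rightarrow> real^'n \<Rightarrow> bool" where
  "eigenpair A l v \<longleftrightarrow> v \<noteq> 0 \<and> A *v v = l *\<^sub>R v"

text \<open>Meaningful for symmetric \<open>A\<close>, where a smallest eigenvalue exists.\<close>

definition lambda_min :: "real^'n^'n \<Rightarrow> real" where
  "lambda_min A = (LEAST l. \<exists>v. eigenpair A l v)"

definition spectral_norm :: "real^'n^'n \<Rightarrow> real" where
  "spectral_norm A = onorm ((*v) A)"

text \<open>The bordered matrix with rows \<open>(t, g\<^sup>T)\<close> and \<open>(g, H)\<close>. The index type \<open>'n option\<close> has
  \<open>CARD('n) + 1\<close> elements; \<open>None\<close> is the index of the additional leading coordinate.\<close>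

definition bordered :: "real \<Rightarrow> real^'n \<Rightarrow> real^'n^'n \<Rightarrow> real^(('n::finite) option)^('n option)" where
  "bordered t g H = (\<chi> i j. case (i, j) of
      (None, None) \<Rightarrow> t
    | (None, Some l) \<Rightarrow> g $ l
    | (Some k, None) \<Rightarrow> g $ k
    | (Some k, Some l) \<Rightarrow> H $ k $ l)"

definition head :: "real^(('n::finite) option) \<Rightarrow> real" where
  "head w = w $ None"

definition tail :: "real^(('n::finite) option) \<Rightarrow> real^'n" where
  "tail w = (\<chi> i. w $ Some i)"

definition epi :: "(real \<Rightarrow> ereal) \<Rightarrow> (real \<times> real) set" where
  "epi f = {(x, r). f x \<le> ereal r}"

definition proper_closed_convex :: "(real \<Rightarrow> ereal) \<Rightarrow> bool" where
  "proper_closed_convex f \<longleftrightarrow>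
     (\<forall>x. f x \<noteq> -\<infinity>) \<and> (\<exists>x. f x \<noteq> \<infinity>) \<and> closed (epi f) \<and> convex (epi f)"

definition monotone_conjugate :: "(real \<Rightarrow> ereal) \<Rightarrow> real \<Rightarrow> ereal" where
  "monotone_conjugate \<rho> u = (SUP t\<in>{0..}. ereal (u * t) - \<rho> t)"

text \<open>An extended-real-valued function is differentiable at a point if it is finite near that point
  and its real-valued version is differentiable there; \<open>ederiv\<close> is then the derivative.\<close>

definition ediff_at :: "(real \<Rightarrow> ereal) \<Rightarrow> real \<Rightarrow> bool" where
  "ediff_at f x \<longleftrightarrow>
     (\<forall>\<^sub>F y in nhds x. \<bar>f y\<bar> \<noteq> \<infinity>) \<and> (\<lambda>y. real_of_ereal (f y)) differentiable (at x)"

definition ederiv :: "(real \<Rightarrow> ereal) \<Rightarrow> real \<Rightarrow> real" where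
  "ederiv f x = deriv (\<lambda>y. real_of_ereal (f y)) x"

definition lam :: "real^'n \<Rightarrow> real^'n^'n \<Rightarrow> real \<Rightarrow> real" where
  "lam g H t = lambda_min (bordered t g H)"

definition khat :: "(real \<Rightarrow> ereal) \<Rightarrow> real^'n \<Rightarrow> real^'n^'n \<Rightarrow> real \<Rightarrow> ereal" where
  "khat \<rho> g H t = (INF \<gamma>\<in>{0..}. \<rho> (\<gamma> - 1) + ereal (\<gamma> * lam g H t))"

definition secular :: "real^'n \<Rightarrow> real^'n^'n \<Rightarrow> real \<Rightarrow> real" where
  "secular g H l = l + g \<bullet> (matrix_inv (H - l *\<^sub>R mat 1) *v g)"

definition tbar :: "real^'n \<Rightarrow> real^'n^'n \<Rightarrow> ereal" where
  "tbar g H = Lim (at_left (lambda_min H)) (\<lambda>l. ereal (secular g H l))"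

definition objective :: "(real \<Rightarrow> ereal) \<Rightarrow> real^'n \<Rightarrow> real^'n^'n \<Rightarrow> real^'n \<Rightarrow> ereal" where
  "objective \<rho> g H x = ereal (2 * (g \<bullet> x) + x \<bullet> (H *v x)) + \<rho> ((norm x)\<^sup>2)"

text \<open>The suprema \<open>\<tau>\<close> and \<open>\<kappa>\<close> are taken in the extended reals, so that their finiteness is a
  genuine claim.\<close>

definition tau :: "(real \<Rightarrow> ereal) \<Rightarrow> real^'n \<Rightarrow> real^'n^'n \<Rightarrow> ereal" where
  "tau \<rho> g H = Sup (ereal ` {\<alpha>. \<alpha> \<ge> 0 \<and>
     \<rho> (\<alpha>\<^sup>2) \<le> ereal (2 * max (2 * norm g * \<alpha>) (spectral_norm H * \<alpha>\<^sup>2))})"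

definition kappa :: "(real \<Rightarrow> ereal) \<Rightarrow> real^'n \<Rightarrow> real^'n^'n \<Rightarrow> ereal" where
  "kappa \<rho> g H = Sup (ereal ` ({0} \<union> {\<beta>. \<beta> > max (lambda_min H) 0 \<and>
     \<beta> * sqrt (ederiv (monotone_conjugate \<rho>) (\<beta> - lambda_min H)) \<le> norm g}))"

end

theory Submission
  imports Defs
begin

text \<open>For symmetric \<open>A\<close>, \<open>lambda_min A\<close> is the minimum of the Rayleigh quotient. For \<open>\<lambda>(t\<^sup>*) < 0\<close>
  closedness and superlinearity give a minimizer \<open>\<gamma>\<close> in the infimum defining \<open>khat\<close> at \<open>t\<^sup>*\<close>, and
  any unit eigenvector \<open>w\<close> with head \<open>v\<^sub>0\<close> gives
  \<open>khat t \<le> khat t\<^sup>* + \<gamma> v\<^sub>0\<^sup>2 (t - t\<^sup>*)\<close>. At a point of differentiability which maximizes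
  \<open>khat t - t\<close> this forces \<open>\<gamma> v\<^sub>0\<^sup>2 = 1\<close>. Hence \<open>v\<^sub>0 \<noteq> 0\<close> and \<open>\<parallel>x\<^sup>*\<parallel>\<^sup>2 = \<gamma> - 1\<close>, so that the dual value is
  attained by \<open>x\<^sup>*\<close>. The bounds on \<open>t\<^sup>*\<close> follow from the eigenvector equations
  \<open>t\<^sup>* + g\<^sup>T x\<^sup>* = \<lambda>\<^sup>*\<close> and \<open>g + H x\<^sup>* = \<lambda>\<^sup>* x\<^sup>*\<close>; the supremum \<open>\<kappa>\<close> enters through
  \<open>(\<rho>\<^sup>+)'(-\<lambda>\<^sup>*) = \<gamma> - 1\<close>.\<close>

section \<open>The smallest eigenvalue\<close>

lemma inner_matrix_sym:
  fixes A :: "real^'n^'n"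
  assumes "transpose A = A"
  shows "x \<bullet> (A *v y) = y \<bullet> (A *v x)"
  using assms by (metis dot_lmul_matrix inner_commute transpose_matrix_vector)

text \<open>A step of length \<open>e\<close> along \<open>- B v\<close> changes the form to first
  order by \<open>- 2 * e * a\<close>, so a small \<open>e\<close> would make it negative unless
  \<open>B v = 0\<close>. This turns a Rayleigh minimizer into an eigenvector without
  differentiation.\<close>

lemma psd_kernel:
  fixes v :: "'a::real_inner"
  assumes "linear B" and sym: "\<And>x y. x \<bullet> B y = y \<bullet> B x"
    and psd: "\<And>x. 0 \<le> x \<bullet> B x" and v: "v \<bullet> B v = 0"
  shows "B v = 0"
proof (rule ccontr)
  interpret linear B by fact
  assume "B v \<noteq> 0"
  define a where "a = B v \<bullet> B v"
  define b where "b = B v \<bullet> B (B v)"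
  have a: "a > 0" using \<open>B v \<noteq> 0\<close> by (simp add: a_def)
  have b: "b \<ge> 0" unfolding b_def by (rule psd)
  have "0 \<le> (v - e *\<^sub>R B v) \<bullet> B (v - e *\<^sub>R B v)" for e by (rule psd)
  then have *: "0 \<le> e * (e * b) - 2 * e * a" for e
    using v sym[of v "B v"] by (simp add: diff scale inner_diff a_def b_def algebra_simps)
  \<comment> \<open>Any positive \<open>e\<close> with \<open>e * b < 2 * a\<close> would do; the
    \<open>+ 1\<close> covers \<open>b = 0\<close>.\<close>
  define e where "e = a / (b + 1)"
  have "e > 0" using a b by (simp add: e_def)
  have "e * b \<le> e * (b + 1)" using \<open>e > 0\<close> by simp
  also have "\<dots> = a" using b by (simp add: e_def)
  finally have "e * b < 2 * a" using a by simp
  then have "e * (e * b) < e * (2 * a)" using \<open>e > 0\<close> by (rule mult_strict_left_mono)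
  then show False using *[of e] by simp
qed

text \<open>For the minimum \<open>m\<close> of the form on the compact unit sphere,
  \<open>A - m I\<close> is positive semidefinite and its form vanishes at the minimizer, so
  \<open>psd_kernel\<close> applies. Every eigenvalue is itself a Rayleigh quotient, hence at least
  \<open>m\<close>.\<close>

lemma lambda_min_rayleigh:
  fixes A :: "real^'n^'n"
  assumes sym: "transpose A = A"
  shows "\<exists>v. norm v = 1 \<and> eigenpair A (lambda_min A) v"
    and "lambda_min A * (x \<bullet> x) \<le> x \<bullet> (A *v x)"
proof -
  have "sphere (0::real^'n) 1 \<noteq> {}" by simp
  moreover have "continuous_on (sphere 0 1) (\<lambda>x. x \<bullet> (A *v x))"
    by (intro continuous_intros linear_continuous_on linear_linear[THEN iffD2] matrix_vector_mul_linear)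
  ultimately obtain v where v: "norm v = 1"
    and min: "\<And>x. norm x = 1 \<Longrightarrow> v \<bullet> (A *v v) \<le> x \<bullet> (A *v x)"
    using continuous_attains_inf[of "sphere (0::real^'n) 1" "\<lambda>x. x \<bullet> (A *v x)"] by auto
  define m where "m = v \<bullet> (A *v v)"
  have vv: "v \<bullet> v = 1" using v by (simp add: dot_square_norm)
  have low: "m * (x \<bullet> x) \<le> x \<bullet> (A *v x)" for x
  proof (cases "x = 0")
    case False
    have "norm ((1 / norm x) *\<^sub>R x) = 1" using False by simp
    from min[OF this] have "m \<le> (x \<bullet> (A *v x)) / (norm x)\<^sup>2"
      by (simp add: m_def matrix_vector_mult_scaleR power2_eq_square)
    then show ?thesis using False by (simp add: dot_square_norm pos_le_divide_eq)
  qed simp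
  define B where "B = (\<lambda>x. A *v x - m *\<^sub>R x)"
  have "linear B" unfolding B_def
    by (intro linear_compose_sub matrix_vector_mul_linear linear_scale_self)
  moreover have "x \<bullet> B y = y \<bullet> B x" for x y
    using inner_matrix_sym[OF sym, of x y] by (simp add: B_def inner_diff inner_commute)
  moreover have "0 \<le> x \<bullet> B x" for x
    using low[of x] by (simp add: B_def inner_diff)
  moreover have "v \<bullet> B v = 0" using vv by (simp add: B_def inner_diff m_def)
  ultimately have "B v = 0" by (rule psd_kernel)
  then have ev: "eigenpair A m v" using v by (auto simp: eigenpair_def B_def)
  have "m \<le> l" if "eigenpair A l u" for l u
  proof -
    have "m * (u \<bullet> u) \<le> l * (u \<bullet> u)" using low[of u] that by (simp add: eigenpair_def)
    then show ?thesis using that by (auto simp: eigenpair_def mult_le_cancel_right inner_gt_zero_iff)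
  qed
  then have "lambda_min A = m"
    unfolding lambda_min_def using ev by (intro Least_equality) auto
  then show "\<exists>v. norm v = 1 \<and> eigenpair A (lambda_min A) v"
    and "lambda_min A * (x \<bullet> x) \<le> x \<bullet> (A *v x)" using ev v low by auto
qed

section \<open>The bordered matrix\<close>

text \<open>Builds the test vectors \<open>join 0 v\<close> and \<open>join 1 x\<close> for the
  bordered form.\<close>

definition join :: "real \<Rightarrow> real^'n \<Rightarrow> real^(('n::finite) option)" where
  "join h x = (\<chi> i. case i of None \<Rightarrow> h | Some k \<Rightarrow> x $ k)"

lemma head_join [simp]: "head (join h x) = h"
  and tail_join [simp]: "tail (join h x) = x"
  by (simp_all add: head_def tail_def join_def)

lemma sum_UNIV_option:
  "(\<Sum>i\<in>(UNIV :: ('n::finite) option set). f i) = f None + (\<Sum>k\<in>UNIV. f (Some k))"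
  by (simp add: UNIV_option_conv sum.reindex)

lemma inner_option: "u \<bullet> w = head u * head w + tail u \<bullet> tail w"
  by (simp add: inner_vec_def sum_UNIV_option head_def tail_def)

lemma head_bordered: "head (bordered t g H *v w) = t * head w + g \<bullet> tail w"
  by (simp add: head_def tail_def bordered_def matrix_vector_mult_def sum_UNIV_option inner_vec_def)

lemma tail_bordered: "tail (bordered t g H *v w) = head w *\<^sub>R g + H *v tail w"
  by (simp add: head_def tail_def bordered_def matrix_vector_mult_def sum_UNIV_option
      inner_vec_def vec_eq_iff)

lemma bordered_form:
  "w \<bullet> (bordered t g H *v w)
    = t * (head w)\<^sup>2 + 2 * head w * (g \<bullet> tail w) + tail w \<bullet> (H *v tail w)"
  by (simp add: inner_option head_bordered tail_bordered inner_add inner_commute power2_eq_square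
      algebra_simps)

lemma bordered_sym:
  assumes "transpose H = H"
  shows "transpose (bordered t g H) = bordered t g H"
proof -
  have "H $ i $ j = H $ j $ i" for i j
    using assms by (metis transpose_def vec_lambda_beta)
  then show ?thesis
    by (auto simp: vec_eq_iff transpose_def bordered_def split: option.splits)
qed

lemma lam_le:
  assumes "transpose H = H"
  shows "lam g H t * (w \<bullet> w) \<le> w \<bullet> (bordered t g H *v w)"
  unfolding lam_def by (rule lambda_min_rayleigh(2)[OF bordered_sym[OF assms]])

lemma lam_eigenvector:
  assumes "transpose H = H"
  obtains w where "norm w = 1" "eigenpair (bordered t g H) (lam g H t) w"
  unfolding lam_def using lambda_min_rayleigh(1)[OF bordered_sym[OF assms]] by blast

lemma eigenpair_form:
  assumes "norm w = 1" "eigenpair A l w"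
  shows "w \<bullet> (A *v w) = l"
  using assms by (simp add: eigenpair_def dot_square_norm)

text \<open>The eigenvector at \<open>t\<close> is a test vector at \<open>s\<close>, and the form
  is affine in the corner entry with slope \<open>(head w)\<^sup>2\<close>, which is thus a
  supergradient of \<open>lam g H\<close> at \<open>t\<close>.\<close>

lemma lam_le_affine:
  assumes sym: "transpose H = H"
    and w: "norm w = 1" "eigenpair (bordered t g H) (lam g H t) w"
  shows "lam g H s \<le> lam g H t + (s - t) * (head w)\<^sup>2"
proof -
  have "lam g H s \<le> w \<bullet> (bordered s g H *v w)"
    using lam_le[OF sym, of g s w] w by (simp add: dot_square_norm)
  moreover have "w \<bullet> (bordered t g H *v w) = lam g H t"
    by (rule eigenpair_form[OF w])
  ultimately show ?thesis by (simp add: bordered_form algebra_simps)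
qed

lemma head_square_le_1:
  assumes "norm w = 1"
  shows "(head w)\<^sup>2 \<le> 1"
proof -
  have "head w * head w + tail w \<bullet> tail w = 1"
    using assms by (metis inner_option dot_square_norm one_power2)
  then show ?thesis by (smt (verit) inner_ge_zero power2_eq_square)
qed

lemma lam_lipschitz:
  assumes sym: "transpose H = H" and "d \<ge> 0"
  shows "lam g H t - d \<le> lam g H (t - d)"
proof -
  obtain w where w: "norm w = 1" "eigenpair (bordered (t - d) g H) (lam g H (t - d)) w"
    using lam_eigenvector[OF sym] .
  have "lam g H t \<le> lam g H (t - d) + d * (head w)\<^sup>2"
    using lam_le_affine[OF sym w, of t] by simp
  also have "\<dots> \<le> lam g H (t - d) + d * 1"
    using head_square_le_1[OF w(1)] \<open>d \<ge> 0\<close> by (intro add_left_mono mult_left_mono) auto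
  finally show ?thesis by simp
qed

text \<open>One inequality of Cauchy interlacing: the test vector is an eigenvector of
  \<open>H\<close> with a zero prepended.\<close>

lemma lam_le_lambda_min:
  assumes sym: "transpose H = H"
  shows "lam g H t \<le> lambda_min H"
proof -
  obtain v where v: "norm v = 1" "eigenpair H (lambda_min H) v"
    using lambda_min_rayleigh(1)[OF sym] by blast
  show ?thesis
    using lam_le[OF sym, of g t "join 0 v"] eigenpair_form[OF v] v(1)
    unfolding bordered_form inner_option[of "join 0 v" "join 0 v"] by (simp add: dot_square_norm)
qed

section \<open>The secular function\<close>

text \<open>\<open>P = H - l I\<close> is positive definite. With \<open>P *v y = g\<close>,
  completing the square shows that the gap in the inequality is
  \<open>(x + y) \<bullet> (P *v (x + y))\<close>, which is zero at \<open>x = - y\<close>. The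
  secular function is thus a maximum of affine functions of \<open>l\<close>, and later arguments
  avoid the inverse matrix.\<close>

lemma secular_variational:
  fixes g :: "real^'n" and H :: "real^'n^'n"
  assumes sym: "transpose H = H" and l: "l < lambda_min H"
  shows "l * (1 + x \<bullet> x) - 2 * (g \<bullet> x) - x \<bullet> (H *v x) \<le> secular g H l"
    and "\<exists>y. secular g H l = l * (1 + y \<bullet> y) - 2 * (g \<bullet> y) - y \<bullet> (H *v y)"
proof -
  define P where "P = H - l *\<^sub>R mat 1"
  have Pv: "P *v z = H *v z - l *\<^sub>R z" for z
    by (simp add: P_def matrix_vector_mult_diff_rdistrib scaleR_matrix_vector_assoc[symmetric])
  have psd: "(lambda_min H - l) * (z \<bullet> z) \<le> z \<bullet> (P *v z)" for z
    using lambda_min_rayleigh(2)[OF sym, of z] by (simp add: Pv inner_diff algebra_simps)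
  have "z = 0" if "P *v z = 0" for z
  proof (rule ccontr)
    assume "z \<noteq> 0"
    then have "0 < (lambda_min H - l) * (z \<bullet> z)" using l by simp
    then show False using psd[of z] that by simp
  qed
  then have "invertible P"
    using invertible_left_inverse matrix_left_invertible_ker by blast
  then have inv: "P ** matrix_inv P = mat 1" 
    unfolding matrix_inv_def invertible_def by (rule someI2_ex) blast
  define y where "y = matrix_inv P *v g"
  have Py: "P *v y = g" by (simp add: y_def matrix_vector_mul_assoc inv)
  have sec: "secular g H l = l + g \<bullet> y" by (simp add: secular_def y_def P_def)
  have symP: "z \<bullet> (P *v z') = z' \<bullet> (P *v z)" for z z'
    using inner_matrix_sym[OF sym, of z z'] by (simp add: Pv inner_diff inner_commute)
  have "0 \<le> (x + y) \<bullet> (P *v (x + y))"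
  proof (rule order_trans[OF _ psd])
    show "0 \<le> (lambda_min H - l) * ((x + y) \<bullet> (x + y))"
      using l by (intro mult_nonneg_nonneg) auto
  qed
  also have "\<dots> = x \<bullet> (P *v x) + 2 * (g \<bullet> x) + g \<bullet> y"
    using symP[of y x] Py by (simp add: matrix_vector_right_distrib inner_add inner_commute)
  finally show "l * (1 + x \<bullet> x) - 2 * (g \<bullet> x) - x \<bullet> (H *v x) \<le> secular g H l"
    by (simp add: sec Pv inner_diff algebra_simps)
  have "y \<bullet> (H *v y) = g \<bullet> y + l * (y \<bullet> y)"
    using arg_cong[OF Py, of "\<lambda>z. y \<bullet> z"] by (simp add: Pv inner_diff inner_commute)
  then have "secular g H l = l * (1 + (- y) \<bullet> (- y)) - 2 * (g \<bullet> (- y)) - (- y) \<bullet> (H *v (- y))"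
    by (simp add: sec algebra_simps linear_neg[OF matrix_vector_mul_linear])
  then show "\<exists>y. secular g H l = l * (1 + y \<bullet> y) - 2 * (g \<bullet> y) - y \<bullet> (H *v y)" by blast
qed

text \<open>A maximizer \<open>y\<close> at \<open>l\<close> gives an affine minorant of positive
  slope \<open>1 + y \<bullet> y\<close>.\<close>

lemma secular_mono:
  assumes sym: "transpose H = H" and "l \<le> l'" "l' < lambda_min H"
  shows "secular g H l \<le> secular g H l'"
proof -
  obtain y where y: "secular g H l = l * (1 + y \<bullet> y) - 2 * (g \<bullet> y) - y \<bullet> (H *v y)"
    using secular_variational(2)[OF sym] assms(2,3) by (meson le_less_trans)
  have "l * (1 + y \<bullet> y) \<le> l' * (1 + y \<bullet> y)" using assms(2) by (intro mult_right_mono) auto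
  then show ?thesis
    using y secular_variational(1)[OF sym assms(3), of y g] by linarith
qed

lemma tendsto_SUP_at_left:
  fixes f :: "real \<Rightarrow> ereal"
  assumes mono: "\<And>x y. x \<le> y \<Longrightarrow> y < a \<Longrightarrow> f x \<le> f y"
  shows "(f \<longlongrightarrow> (SUP x\<in>{..<a}. f x)) (at_left a)"
proof (rule order_tendstoI)
  fix c assume "c < (SUP x\<in>{..<a}. f x)"
  then obtain x where x: "x < a" "c < f x" by (auto simp: less_SUP_iff)
  have "\<forall>\<^sub>F y in at_left a. y \<in> {x<..<a}" using x(1) by (rule eventually_at_left_real)
  then show "\<forall>\<^sub>F y in at_left a. c < f y"
    by eventually_elim (use x mono in \<open>force intro: less_le_trans\<close>)
next
  fix c assume c: "(SUP x\<in>{..<a}. f x) < c"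
  have "\<forall>\<^sub>F y in at_left a. y \<in> {a - 1<..<a}" by (rule eventually_at_left_real) simp
  then show "\<forall>\<^sub>F y in at_left a. f y < c"
    by eventually_elim (use c in \<open>auto intro: le_less_trans[OF SUP_upper]\<close>)
qed

text \<open>Monotonicity makes the one-sided limit exist, so \<open>Lim\<close> in
  \<open>tbar\<close> denotes a genuine limit, possibly infinite.\<close>

lemma tbar_eq_SUP:
  assumes sym: "transpose H = H"
  shows "((\<lambda>l. ereal (secular g H l)) \<longlongrightarrow> tbar g H) (at_left (lambda_min H))"
    and "tbar g H = (SUP l\<in>{..<lambda_min H}. ereal (secular g H l))"
proof -
  have lim: "((\<lambda>l. ereal (secular g H l)) \<longlongrightarrow> (SUP l\<in>{..<lambda_min H}. ereal (secular g H l)))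
      (at_left (lambda_min H))"
    by (rule tendsto_SUP_at_left) (simp add: secular_mono[OF sym])
  then show *: "tbar g H = (SUP l\<in>{..<lambda_min H}. ereal (secular g H l))"
    unfolding tbar_def by (intro tendsto_Lim) simp
  show "((\<lambda>l. ereal (secular g H l)) \<longlongrightarrow> tbar g H) (at_left (lambda_min H))"
    unfolding * by (rule lim)
qed

text \<open>Fixing \<open>x\<close> in the variational formula gives an affine minorant
  \<open>q\<close> of the secular function with \<open>q l0 = t\<close> and positive slope. Passing
  to the limit also covers \<open>l0 = lambda_min H\<close>, where \<open>H - l0 I\<close> is
  singular.\<close>

lemma tbar_ge:
  assumes sym: "transpose H = H"
    and x: "l0 \<le> lambda_min H" "t = l0 - g \<bullet> x" "g + H *v x = l0 *\<^sub>R x"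
  shows "ereal t \<le> tbar g H"
proof -
  define q where "q = (\<lambda>l. l * (1 + x \<bullet> x) - 2 * (g \<bullet> x) - x \<bullet> (H *v x))"
  have "x \<bullet> (H *v x) = l0 * (x \<bullet> x) - g \<bullet> x"
    using arg_cong[OF x(3), of "\<lambda>z. x \<bullet> z"] by (simp add: inner_add inner_commute)
  then have q: "q l = t + (l - l0) * (1 + x \<bullet> x)" for l
    by (simp add: q_def x(2) algebra_simps)
  have "isCont q (lambda_min H)" unfolding q_def by (intro continuous_intros)
  then have "(q \<longlongrightarrow> q (lambda_min H)) (at_left (lambda_min H))"
    by (simp add: isCont_def filterlim_at_split)
  then have "((\<lambda>l. ereal (q l)) \<longlongrightarrow> ereal (q (lambda_min H))) (at_left (lambda_min H))"
    by simp
  moreover have "\<forall>\<^sub>F l in at_left (lambda_min H). ereal (q l) \<le> ereal (secular g H l)"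
    using eventually_at_left_real[of "lambda_min H - 1" "lambda_min H"]
    by (auto elim!: eventually_mono simp: q_def intro!: secular_variational(1)[OF sym])
  ultimately have "ereal (q (lambda_min H)) \<le> tbar g H"
    by (intro tendsto_le[OF _ tbar_eq_SUP(1)[OF sym]]) simp
  moreover have "t \<le> q (lambda_min H)" using x(1) by (simp add: q)
  ultimately show ?thesis by (meson ereal_less_eq(3) order_trans)
qed

section \<open>Affine bounds and derivatives\<close>

text \<open>Subtracting \<open>c * y\<close> leaves a function with a local maximum at
  \<open>x\<close>.\<close>

lemma deriv_eq_majorant_slope:
  fixes f :: "real \<Rightarrow> real"
  assumes "f differentiable (at x)" and "\<forall>\<^sub>F y in nhds x. f y \<le> f x + c * (y - x)"
  shows "deriv f x = c"
proof -
  have "(f has_real_derivative deriv f x) (at x)"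
    using assms(1) by (simp add: DERIV_deriv_iff_real_differentiable)
  then have D: "((\<lambda>y. f y - c * y) has_real_derivative deriv f x - c) (at x)"
    by (auto intro!: derivative_eq_intros)
  obtain d where "d > 0" "\<And>y. dist y x < d \<Longrightarrow> f y \<le> f x + c * (y - x)"
    using assms(2) by (auto simp: eventually_nhds_metric)
  then have "\<forall>y. \<bar>x - y\<bar> < d \<longrightarrow> f y - c * y \<le> f x - c * x"
    by (auto simp: dist_real_def algebra_simps abs_minus_commute)
  from DERIV_local_max[OF D \<open>d > 0\<close> this] show ?thesis by simp
qed

text \<open>All affine majorants touching at \<open>x\<close> share one slope; comparing such
  majorants of \<open>khat\<close> at \<open>tstar\<close> drives the main proof.\<close>

lemma ederiv_eq_majorant_slope:
  assumes "ediff_at f x" and le: "\<And>y. f y \<le> f x + ereal (c * (y - x))"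
  shows "ederiv f x = c"
  unfolding ederiv_def
proof (rule deriv_eq_majorant_slope)
  have fin: "\<forall>\<^sub>F y in nhds x. \<bar>f y\<bar> \<noteq> \<infinity>" using assms(1) by (simp add: ediff_at_def)
  then have "\<bar>f x\<bar> \<noteq> \<infinity>" by (rule eventually_nhds_x_imp_x)
  then obtain a where a: "f x = ereal a" by auto
  show "\<forall>\<^sub>F y in nhds x. real_of_ereal (f y) \<le> real_of_ereal (f x) + c * (y - x)"
    using fin
  proof eventually_elim
    case (elim y)
    then obtain b where "f y = ereal b" by auto
    then show ?case using le[of y] a by simp
  qed
qed (use assms(1) in \<open>simp add: ediff_at_def\<close>)

lemma ederiv_eq_minorant_slope:
  assumes diff: "ediff_at f x" and ge: "\<And>y. f x + ereal (c * (y - x)) \<le> f y"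
  shows "ederiv f x = c"
proof -
  define h where "h = (\<lambda>y. - real_of_ereal (f y))"
  have fin: "\<forall>\<^sub>F y in nhds x. \<bar>f y\<bar> \<noteq> \<infinity>" and d: "(\<lambda>y. real_of_ereal (f y)) differentiable (at x)"
    using diff by (simp_all add: ediff_at_def)
  have "\<bar>f x\<bar> \<noteq> \<infinity>" using fin by (rule eventually_nhds_x_imp_x)
  then obtain a where a: "f x = ereal a" by auto
  have "\<forall>\<^sub>F y in nhds x. h y \<le> h x + (- c) * (y - x)"
    using fin
  proof eventually_elim
    case (elim y)
    then obtain b where "f y = ereal b" by auto
    then show ?case using ge[of y] a by (simp add: h_def)
  qed
  moreover have "h differentiable (at x)" unfolding h_def using d by (rule differentiable_minus)
  ultimately have "deriv h x = - c" by (intro deriv_eq_majorant_slope)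
  moreover have "deriv h x = - ederiv f x"
    unfolding h_def ederiv_def using d
    by (intro DERIV_imp_deriv DERIV_minus) (simp add: DERIV_deriv_iff_real_differentiable)
  ultimately show ?thesis by simp
qed

section \<open>The regularizer and its conjugate\<close>

locale regularizer =
  fixes \<rho> :: "real \<Rightarrow> ereal"
  assumes nonneg: "0 \<le> \<rho> t"
    and closed_epi: "closed (epi \<rho>)"
    and nonpos_arg: "t \<le> 0 \<Longrightarrow> \<rho> t = 0"
    and superlinear: "((\<lambda>t. \<rho> t / ereal t) \<longlongrightarrow> \<infinity>) at_top"
begin

text \<open>Serves twice: it confines the supremum in the conjugate to a compact set, and it bounds
  \<open>tau\<close>.\<close>

lemma eventually_above_linear: "\<exists>T>0. \<forall>t\<ge>T. ereal (K * t) < \<rho> t"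
proof -
  have "\<forall>\<^sub>F t in at_top. ereal K < \<rho> t / ereal t"
    using superlinear by (rule order_tendstoD) simp
  then obtain T where T: "\<And>t. t \<ge> T \<Longrightarrow> ereal K < \<rho> t / ereal t"
    by (auto simp: eventually_at_top_linorder)
  have "ereal (K * t) < \<rho> t" if "t \<ge> max T 1" for t
  proof (cases "\<rho> t")
    case (real r)
    then show ?thesis using T[of t] that by (simp add: pos_less_divide_eq)
  qed (use nonneg[of t] in auto)
  then show ?thesis by (intro exI[of _ "max T 1"]) auto
qed

text \<open>\<open>u\<close> is a subgradient of \<open>\<rho>\<close> at \<open>s\<close>, that is, \<open>s\<close> attains the supremum defining \<open>\<rho>\<^sup>+(u)\<close>.\<close>

definition attains :: "real \<Rightarrow> real \<Rightarrow> real \<Rightarrow> bool" where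
  "attains u s p \<longleftrightarrow> 0 \<le> s \<and> \<rho> s = ereal p \<and> (\<forall>t. ereal (p + u * (t - s)) \<le> \<rho> t)"

text \<open>Lower semicontinuity of \<rho> is available as closedness of the epigraph, so the linear
  function \<open>r - u * t\<close> is minimized over a compact piece of the epigraph instead of
  \<open>\<rho> t - u * t\<close> over the line.\<close>

lemma attains_exists:
  assumes u: "u \<ge> 0"
  obtains s p where "attains u s p"
proof -
  obtain T where T: "T > 0" "\<And>t. t \<ge> T \<Longrightarrow> ereal (u * t) < \<rho> t"
    using eventually_above_linear by blast
  \<comment> \<open>The piece contains \<open>(0, 0)\<close>, so the minimum is at most 0. A point
    of the graph that it misses has \<open>\<rho> t \<ge> u * t\<close>: for
    \<open>t \<le> 0\<close> by sign, beyond \<open>T\<close> by the choice of \<open>T\<close>, and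
    above height \<open>u * T\<close> because \<open>t \<le> T\<close>.\<close>
  define C where "C = epi \<rho> \<inter> ({0..T} \<times> {0..u * T})"
  have "compact C"
    unfolding C_def by (intro closed_Int_compact closed_epi compact_Times compact_Icc)
  moreover have zero: "(0, 0) \<in> C"
    using T(1) u nonpos_arg[of 0] by (simp add: C_def epi_def zero_ereal_def)
  moreover have "continuous_on C (\<lambda>z. snd z - u * fst z)" by (intro continuous_intros)
  ultimately obtain s r where sr: "(s, r) \<in> C"
    and min: "\<And>t q. (t, q) \<in> C \<Longrightarrow> r - u * s \<le> q - u * t"
    using continuous_attains_inf[of C "\<lambda>z. snd z - u * fst z"] by fastforce
  have "\<rho> s \<le> ereal r" using sr by (simp add: C_def epi_def)
  then obtain p where p: "\<rho> s = ereal p" "p \<le> r" using nonneg[of s] by (cases "\<rho> s") auto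
  have neg: "r - u * s \<le> 0" using min[OF zero] by simp
  have above: "ereal (p + u * (t - s)) \<le> \<rho> t" if "ereal (u * t) \<le> \<rho> t" for t
  proof -
    have "p + u * (t - s) \<le> u * t" using neg p(2) by (simp add: algebra_simps)
    then show ?thesis using that by (meson ereal_less_eq(3) order_trans)
  qed
  have "ereal (p + u * (t - s)) \<le> \<rho> t" for t
  proof (cases "t \<le> 0 \<or> t > T \<or> \<rho> t > ereal (u * T)")
    case True
    then consider "t \<le> 0" | "t > T" | "0 \<le> t" "t \<le> T" "\<rho> t > ereal (u * T)" by linarith
    then have "ereal (u * t) \<le> \<rho> t"
    proof cases
      case 1
      then have "u * t \<le> 0" using u by (simp add: mult_nonneg_nonpos)
      then show ?thesis using nonpos_arg[OF 1] by (simp add: zero_ereal_def)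
    next
      case 2
      then show ?thesis using T(2)[of t] by simp
    next
      case 3
      then have "u * t \<le> u * T" using u by (simp add: mult_left_mono)
      then show ?thesis using 3(3) by (meson ereal_less_eq(3) less_imp_le order_trans)
    qed
    then show ?thesis by (rule above)
  next
    case False
    then obtain q where q: "\<rho> t = ereal q" using nonneg[of t] by (cases "\<rho> t") auto
    then have "(t, q) \<in> C" using False nonneg[of t] by (simp add: C_def epi_def)
    from min[OF this] show ?thesis using p(2) by (simp add: q algebra_simps)
  qed
  then have "attains u s p" using p sr by (simp add: attains_def C_def)
  then show thesis by (rule that)
qed

lemma conjugate_ge:
  assumes "attains u s p"
  shows "ereal (y * s - p) \<le> monotone_conjugate \<rho> y"
  unfolding monotone_conjugate_def
  using assms by (intro SUP_upper2[of s]) (auto simp: attains_def)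

lemma conjugate_eq:
  assumes "attains u s p"
  shows "monotone_conjugate \<rho> u = ereal (u * s - p)"
proof (rule antisym[OF _ conjugate_ge[OF assms]])
  have "ereal (u * t) - \<rho> t \<le> ereal (u * s - p)" for t
  proof (cases "\<rho> t")
    case (real r)
    have "ereal (p + u * (t - s)) \<le> \<rho> t" using assms by (simp add: attains_def)
    then show ?thesis using real by (simp add: algebra_simps)
  qed (use nonneg[of t] in auto)
  then show "monotone_conjugate \<rho> u \<le> ereal (u * s - p)"
    unfolding monotone_conjugate_def by (intro SUP_least) auto
qed

text \<open>The affine function \<open>y * s - p\<close> of \<open>y\<close> lies below the
  conjugate and touches it at \<open>u\<close>.\<close>

lemma ederiv_conjugate:
  assumes "attains u s p" "ediff_at (monotone_conjugate \<rho>) u"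
  shows "ederiv (monotone_conjugate \<rho>) u = s"
proof (rule ederiv_eq_minorant_slope[OF assms(2)])
  fix y
  show "monotone_conjugate \<rho> u + ereal (s * (y - u)) \<le> monotone_conjugate \<rho> y"
    using conjugate_ge[OF assms(1), of y] by (simp add: conjugate_eq[OF assms(1)] algebra_simps)
qed

text \<open>The choice \<open>\<gamma> = 0\<close> costs \<open>\<rho> (- 1) = 0\<close>.\<close>

lemma khat_nonpos: "khat \<rho> g H t \<le> 0"
  unfolding khat_def using nonpos_arg[of "-1"] by (intro INF_lower2[of 0]) auto

lemma khat_nonneg: "lam g H t \<ge> 0 \<Longrightarrow> 0 \<le> khat \<rho> g H t"
  unfolding khat_def by (intro INF_greatest add_nonneg_nonneg nonneg) auto

lemma khat_le:
  "s \<ge> 0 \<Longrightarrow> khat \<rho> g H t \<le> \<rho> s + ereal ((1 + s) * lam g H t)"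
  unfolding khat_def by (intro INF_lower2[of "1 + s"]) auto

text \<open>Up to the summand \<open>lam g H t\<close>, the infimum is that of
  \<open>\<rho> t' - u * t'\<close> with \<open>u = - lam g H t\<close> and
  \<open>t' = \<gamma> - 1\<close>. The subgradient inequality therefore makes
  \<open>\<gamma> = 1 + s\<close> optimal.\<close>

lemma khat_eq:
  assumes a: "attains (- lam g H t) s p"
  shows "khat \<rho> g H t = ereal (p + (1 + s) * lam g H t)"
proof (rule antisym)
  show "khat \<rho> g H t \<le> ereal (p + (1 + s) * lam g H t)"
    using khat_le[of s g H t] a by (simp add: attains_def)
  have "ereal (p + (1 + s) * lam g H t) \<le> \<rho> (\<gamma> - 1) + ereal (\<gamma> * lam g H t)" for \<gamma>
  proof (cases "\<rho> (\<gamma> - 1)")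
    case (real r)
    have "ereal (p - lam g H t * (\<gamma> - 1 - s)) \<le> \<rho> (\<gamma> - 1)"
      using a unfolding attains_def by (metis add_uminus_conv_diff mult_minus_left)
    then show ?thesis using real by (simp add: algebra_simps)
  qed (use nonneg[of "\<gamma> - 1"] in auto)
  then show "ereal (p + (1 + s) * lam g H t) \<le> khat \<rho> g H t"
    unfolding khat_def by (intro INF_greatest)
qed

end

theorem theorem3p8:
  fixes g :: "real^'n" and H :: "real^'n^'n"
    and \<rho> :: "real \<Rightarrow> ereal" and tstar :: real
  assumes g_nz: "g \<noteq> 0"
    and H_sym: "transpose H = H"
    and rho_nonneg: "\<forall>t. 0 \<le> \<rho> t"
    and rho_pcc: "proper_closed_convex \<rho>"
    and rho_0: "\<rho> 0 = 0"
    and rho_mono: "mono \<rho>"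
    and rho_nonpos_arg: "\<forall>t\<le>0. \<rho> t = 0"
    and rho_fin: "\<exists>t0>0. \<rho> t0 < \<infinity>"
    and rho_superlinear: "((\<lambda>t. \<rho> t / ereal t) \<longlongrightarrow> \<infinity>) at_top"
    and conj_diff: "\<forall>t>0. ediff_at (monotone_conjugate \<rho>) t"
    and tstar_max: "\<forall>t. khat \<rho> g H t - ereal t \<le> khat \<rho> g H tstar - ereal tstar"
  shows "((\<lambda>l. ereal (secular g H l)) \<longlongrightarrow> tbar g H) (at_left (lambda_min H)) \<and> tbar g H \<noteq> -\<infinity>
    \<and> lam g H tstar \<le> 0
    \<and> (ediff_at (khat \<rho> g H) tstar \<longrightarrow>
        lam g H tstar < 0
        \<and> (\<forall>w. norm w = 1 \<and> eigenpair (bordered tstar g H) (lam g H tstar) w \<longrightarrow>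
              head w \<noteq> 0
              \<and> (\<forall>x. objective \<rho> g H ((1 / head w) *\<^sub>R tail w) \<le> objective \<rho> g H x))
        \<and> \<bar>tau \<rho> g H\<bar> \<noteq> \<infinity> \<and> \<bar>kappa \<rho> g H\<bar> \<noteq> \<infinity>
        \<and> (\<forall>\<eta> \<zeta>. tau \<rho> g H \<le> ereal \<eta> \<and> kappa \<rho> g H \<le> ereal \<zeta> \<longrightarrow>
              ereal (lambda_min H - \<zeta>) \<le> ereal tstar
              \<and> ereal tstar \<le> min (tbar g H) (ereal (lambda_min H + \<eta> * norm g))))"
proof -
  interpret regularizer \<rho>
    using rho_nonneg rho_pcc rho_nonpos_arg rho_superlinear
    by unfold_locales (auto simp: proper_closed_convex_def)

  \<comment> \<open>Lower finiteness of the limit \<open>tbar\<close>\<close>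
  have tbar_ninf: "tbar g H \<noteq> -\<infinity>"
  proof -
    have "ereal (secular g H (lambda_min H - 1)) \<le> tbar g H"
      unfolding tbar_eq_SUP(2)[OF H_sym] by (intro SUP_upper) simp
    then show ?thesis by auto
  qed

  \<comment> \<open>Sign of the smallest eigenvalue at \<open>tstar\<close>\<close>
  have lam_le_0: "lam g H tstar \<le> 0"
  proof (rule ccontr)
    assume "\<not> lam g H tstar \<le> 0"
    \<comment> \<open>Moving left by \<open>d\<close> keeps \<open>lam\<close> nonnegative, so
      \<open>khat\<close> vanishes at both points while \<open>khat t - t\<close> grows by
      \<open>d\<close>.\<close>
    define d where "d = lam g H tstar"
    have d: "d > 0" using \<open>\<not> lam g H tstar \<le> 0\<close> by (simp add: d_def)
    have "lam g H (tstar - d) \<ge> 0"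
      using lam_lipschitz[OF H_sym, of d g tstar] d by (simp add: d_def)
    moreover have "lam g H tstar \<ge> 0" using d by (simp add: d_def)
    ultimately have "khat \<rho> g H (tstar - d) = 0" "khat \<rho> g H tstar = 0"
      by (auto intro!: antisym khat_nonpos khat_nonneg)
    then show False using tstar_max[rule_format, of "tstar - d"] d by simp
  qed
  have main: "lam g H tstar < 0
        \<and> (\<forall>w. norm w = 1 \<and> eigenpair (bordered tstar g H) (lam g H tstar) w \<longrightarrow>
              head w \<noteq> 0
              \<and> (\<forall>x. objective \<rho> g H ((1 / head w) *\<^sub>R tail w) \<le> objective \<rho> g H x))
        \<and> \<bar>tau \<rho> g H\<bar> \<noteq> \<infinity> \<and> \<bar>kappa \<rho> g H\<bar> \<noteq> \<infinity>
        \<and> (\<forall>\<eta> \<zeta>. tau \<rho> g H \<le> ereal \<eta> \<and> kappa \<rho> g H \<le> ereal \<zeta> \<longrightarrow>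
              ereal (lambda_min H - \<zeta>) \<le> ereal tstar
              \<and> ereal tstar \<le> min (tbar g H) (ereal (lambda_min H + \<eta> * norm g)))"
    if diff: "ediff_at (khat \<rho> g H) tstar"
  proof -

    \<comment> \<open>Dual optimality at \<open>tstar\<close>\<close>
    define L where "L = lam g H tstar"
    have "L \<le> 0" using lam_le_0 by (simp add: L_def)
    then have "0 \<le> - L" by simp
    then obtain s p where att: "attains (- L) s p" by (rule attains_exists)
    have s: "s \<ge> 0" and ps: "\<rho> s = ereal p" using att by (auto simp: attains_def)
    have khat_star: "khat \<rho> g H tstar = ereal (p + (1 + s) * L)"
      using khat_eq[of g H tstar s p] att by (simp add: L_def)
    \<comment> \<open>Maximality of \<open>khat t - t\<close> says that the line of slope 1 through
      the graph at \<open>tstar\<close> is a majorant.\<close>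
    have deriv_1: "ederiv (khat \<rho> g H) tstar = 1"
    proof (rule ederiv_eq_majorant_slope[OF diff])
      fix t
      show "khat \<rho> g H t \<le> khat \<rho> g H tstar + ereal (1 * (t - tstar))"
        using tstar_max[rule_format, of t] unfolding khat_star
        by (cases "khat \<rho> g H t") auto
    qed
    \<comment> \<open>For \<open>L = 0\<close> the constant 0 would be a touching majorant as well,
      of slope 0.\<close>
    have "L \<noteq> 0"
    proof
      assume "L = 0"
      then have "khat \<rho> g H tstar = 0"
        by (intro antisym khat_nonpos khat_nonneg) (simp add: L_def)
      then have "ederiv (khat \<rho> g H) tstar = 0"
        using khat_nonpos by (intro ederiv_eq_majorant_slope[OF diff]) (simp add: zero_ereal_def)
      with deriv_1 show False by simp
    qed
    then have L_neg: "L < 0" using \<open>L \<le> 0\<close> by simp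

    \<comment> \<open>Unit eigenvectors for \<open>L\<close>\<close>
    have eigenvector: "head w \<noteq> 0" "(norm ((1 / head w) *\<^sub>R tail w))\<^sup>2 = s"
        "tstar + g \<bullet> ((1 / head w) *\<^sub>R tail w) = L"
        "g + H *v ((1 / head w) *\<^sub>R tail w) = L *\<^sub>R ((1 / head w) *\<^sub>R tail w)"
      if w: "norm w = 1" "eigenpair (bordered tstar g H) L w" for w
    proof -
      \<comment> \<open>Keeping \<open>\<gamma> = 1 + s\<close> and the test vector \<open>w\<close>
        fixed while \<open>t\<close> varies gives an affine majorant of \<open>khat\<close>.\<close>
      have "ederiv (khat \<rho> g H) tstar = (1 + s) * (head w)\<^sup>2"
      proof (rule ederiv_eq_majorant_slope[OF diff])
        fix t
        have "lam g H t \<le> L + (t - tstar) * (head w)\<^sup>2"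
          using lam_le_affine[OF H_sym, of w tstar g t] w by (simp add: L_def)
        then have "(1 + s) * lam g H t \<le> (1 + s) * (L + (t - tstar) * (head w)\<^sup>2)"
          using s by (intro mult_left_mono) auto
        then have "p + (1 + s) * lam g H t \<le> p + (1 + s) * L + (1 + s) * (head w)\<^sup>2 * (t - tstar)"
          by (simp add: algebra_simps)
        then show "khat \<rho> g H t \<le> khat \<rho> g H tstar + ereal ((1 + s) * (head w)\<^sup>2 * (t - tstar))"
          using khat_le[OF s, of g H t] unfolding khat_star ps
          by (auto intro: order_trans)
      qed
      then have hs: "(1 + s) * (head w)\<^sup>2 = 1" using deriv_1 by simp
      then show h: "head w \<noteq> 0" by auto
      have "head w * head w + tail w \<bullet> tail w = 1"
        using w(1) by (metis inner_option dot_square_norm one_power2)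
      then have "(norm (tail w))\<^sup>2 = s * (head w)\<^sup>2"
        using hs unfolding power2_norm_eq_inner by (simp add: algebra_simps power2_eq_square)
      then have "(norm ((1 / head w) *\<^sub>R tail w))\<^sup>2 = (1 / head w)\<^sup>2 * (s * (head w)\<^sup>2)"
        by (simp only: norm_scaleR power_mult_distrib power2_abs)
      also have "\<dots> = s" using h by (simp add: field_simps)
      finally show "(norm ((1 / head w) *\<^sub>R tail w))\<^sup>2 = s" .
      have eq: "bordered tstar g H *v w = L *\<^sub>R w" using w(2) by (simp add: eigenpair_def)
      have "tstar * head w + g \<bullet> tail w = L * head w"
        using arg_cong[OF eq, of head] by (simp add: head_bordered) (simp add: head_def)
      then show "tstar + g \<bullet> ((1 / head w) *\<^sub>R tail w) = L"
        using h by (simp add: field_simps)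
      have "head w *\<^sub>R g + H *v tail w = L *\<^sub>R tail w"
        using arg_cong[OF eq, of tail] by (simp add: tail_bordered) (simp add: tail_def vec_eq_iff)
      then have "(1 / head w) *\<^sub>R (head w *\<^sub>R g + H *v tail w) = (1 / head w) *\<^sub>R (L *\<^sub>R tail w)"
        by simp
      then show "g + H *v ((1 / head w) *\<^sub>R tail w) = L *\<^sub>R ((1 / head w) *\<^sub>R tail w)"
        using h by (simp add: scaleR_add_right matrix_vector_mult_scaleR mult.commute)
    qed

    \<comment> \<open>Weak duality and attainment\<close>
    have objective_ge: "ereal (p + (1 + s) * L - tstar) \<le> objective \<rho> g H x" for x
    proof -
      \<comment> \<open>The bound combines \<open>\<gamma> = 1 + (norm x)\<^sup>2\<close> in the
        infimum with the test vector \<open>join 1 x\<close>.\<close>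
      have "khat \<rho> g H tstar \<le> \<rho> ((norm x)\<^sup>2) + ereal ((1 + (norm x)\<^sup>2) * L)"
        unfolding L_def by (rule khat_le) simp
      moreover have "(1 + (norm x)\<^sup>2) * L \<le> tstar + (2 * (g \<bullet> x) + x \<bullet> (H *v x))"
        using lam_le[OF H_sym, of g tstar "join 1 x"]
        unfolding bordered_form inner_option[of "join 1 x" "join 1 x"]
        by (simp add: L_def dot_square_norm mult.commute)
      ultimately show ?thesis
        unfolding khat_star objective_def
        by (cases "\<rho> ((norm x)\<^sup>2)") auto
    qed
    have objective_le: "objective \<rho> g H x \<le> ereal (p + (1 + s) * L - tstar)"
      if x: "(norm x)\<^sup>2 = s" "tstar + g \<bullet> x = L" "g + H *v x = L *\<^sub>R x" for x
    proof -
      \<comment> \<open>Adding this to \<open>g \<bullet> x = L - tstar\<close> produces the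
        quadratic part of the objective.\<close>
      have "x \<bullet> (g + H *v x) = L * s" using x(1,3) by (simp add: dot_square_norm)
      then have "2 * (g \<bullet> x) + x \<bullet> (H *v x) = (1 + s) * L - tstar"
        using x(2) by (simp add: inner_add inner_commute algebra_simps)
      then show ?thesis by (simp add: objective_def x(1) ps)
    qed

    \<comment> \<open>Spectral norm estimates and finiteness of \<open>tau\<close>\<close>
    have xHx: "\<bar>x \<bullet> (H *v x)\<bar> \<le> spectral_norm H * (norm x)\<^sup>2" for x
    proof -
      have "\<bar>x \<bullet> (H *v x)\<bar> \<le> norm x * norm (H *v x)" by (rule Cauchy_Schwarz_ineq2)
      also have "\<dots> \<le> norm x * (spectral_norm H * norm x)"
        unfolding spectral_norm_def
        by (intro mult_left_mono onorm matrix_vector_mul_bounded_linear) simp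
      finally show ?thesis by (simp add: power2_eq_square mult_ac)
    qed
    have H_nonneg: "spectral_norm H \<ge> 0"
      unfolding spectral_norm_def by (intro onorm_pos_le matrix_vector_mul_bounded_linear)

    have tau_ge: "tau \<rho> g H \<ge> ereal \<alpha>"
      if "\<alpha> \<ge> 0" "\<rho> (\<alpha>\<^sup>2) \<le> ereal (2 * max (2 * norm g * \<alpha>) (spectral_norm H * \<alpha>\<^sup>2))" for \<alpha>
      unfolding tau_def using that by (intro Sup_upper imageI) simp
    have tau_fin: "\<bar>tau \<rho> g H\<bar> \<noteq> \<infinity>"
    proof -
      \<comment> \<open>For \<open>\<alpha> \<ge> 1\<close> the maximum is at most the sum of its
        entries, and \<open>\<alpha> \<le> \<alpha>\<^sup>2\<close> gives the common bound
        \<open>K * \<alpha>\<^sup>2\<close>.\<close>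
      define K where "K = 2 * (2 * norm g + spectral_norm H)"
      obtain T where T: "\<And>t. t \<ge> T \<Longrightarrow> ereal (K * t) < \<rho> t"
        using eventually_above_linear by blast
      define B where "B = max 1 T"
      have "\<alpha> \<le> B"
        if \<alpha>: "\<rho> (\<alpha>\<^sup>2) \<le> ereal (2 * max (2 * norm g * \<alpha>) (spectral_norm H * \<alpha>\<^sup>2))" for \<alpha>
      proof (rule ccontr)
        assume "\<not> \<alpha> \<le> B"
        then have *: "\<alpha> > 1" "\<alpha> > T" by (auto simp: B_def)
        then have sq: "\<alpha> \<le> \<alpha>\<^sup>2" by (simp add: power2_eq_square)
        have "2 * norm g * \<alpha> \<le> 2 * norm g * \<alpha>\<^sup>2" using sq by (intro mult_left_mono) auto
        moreover have "0 \<le> spectral_norm H * \<alpha>\<^sup>2" "0 \<le> 2 * norm g * \<alpha>\<^sup>2" using H_nonneg by auto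
        moreover have "K * \<alpha>\<^sup>2 = 2 * (2 * norm g * \<alpha>\<^sup>2) + 2 * (spectral_norm H * \<alpha>\<^sup>2)"
          by (simp add: K_def algebra_simps)
        ultimately have "2 * max (2 * norm g * \<alpha>) (spectral_norm H * \<alpha>\<^sup>2) \<le> K * \<alpha>\<^sup>2"
          by linarith
        then have "\<rho> (\<alpha>\<^sup>2) \<le> ereal (K * \<alpha>\<^sup>2)" using order_trans[OF \<alpha>] by simp
        moreover have "T \<le> \<alpha>\<^sup>2" using * sq by linarith
        ultimately show False using T[of "\<alpha>\<^sup>2"] by (simp add: not_le[symmetric])
      qed
      then have "tau \<rho> g H \<le> ereal B"
        unfolding tau_def by (intro Sup_least) auto
      moreover have "ereal 0 \<le> tau \<rho> g H"
        by (rule tau_ge) (simp_all add: nonpos_arg)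
      ultimately show ?thesis by auto
    qed

    \<comment> \<open>Finiteness of \<open>kappa\<close>\<close>
    have kappa_ge0: "0 \<le> kappa \<rho> g H"
      unfolding kappa_def zero_ereal_def by (intro Sup_upper imageI) simp
    have kappa_fin: "\<bar>kappa \<rho> g H\<bar> \<noteq> \<infinity>"
    proof -
      obtain t0 where t0: "t0 > 0" "\<rho> t0 < \<infinity>" using rho_fin by blast
      then obtain r0 where r0: "\<rho> t0 = ereal r0" using nonneg[of t0] by (cases "\<rho> t0") auto
      \<comment> \<open>Beyond the first bound the subgradient inequality at \<open>t0\<close>
        forces the conjugate's derivative above \<open>t0 / 2\<close>; beyond the second,
        \<open>\<beta> * sqrt (t0 / 2)\<close> exceeds \<open>norm g\<close>.\<close>
      define B where "B = max 0 (max (lambda_min H + 2 * r0 / t0) (norm g / sqrt (t0 / 2)))"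
      have "\<beta> \<le> B"
        if \<beta>: "\<beta> > max (lambda_min H) 0"
          "\<beta> * sqrt (ederiv (monotone_conjugate \<rho>) (\<beta> - lambda_min H)) \<le> norm g" for \<beta>
      proof (rule ccontr)
        assume "\<not> \<beta> \<le> B"
        then have *: "\<beta> - lambda_min H > 2 * r0 / t0" "\<beta> > norm g / sqrt (t0 / 2)"
          by (auto simp: B_def)
        define u where "u = \<beta> - lambda_min H"
        have u: "u > 0" using \<beta>(1) by (simp add: u_def)
        obtain s' p' where a: "attains u s' p'" using attains_exists[of u] u by auto
        have "ereal (p' + u * (t0 - s')) \<le> ereal r0" "0 \<le> ereal p'"
          using a nonneg[of s'] r0 unfolding attains_def by metis+
        then have "u * (t0 - s') \<le> r0" by simp
        also have "r0 < u * (t0 / 2)" using *(1) t0(1) by (simp add: u_def field_simps)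
        finally have "t0 / 2 < s'" using u by (simp add: mult_less_cancel_left)
        moreover have "ederiv (monotone_conjugate \<rho>) u = s'"
          using ederiv_conjugate[OF a] conj_diff u by simp
        ultimately have "norm g / sqrt (t0 / 2) * sqrt (t0 / 2)
            < \<beta> * sqrt (ederiv (monotone_conjugate \<rho>) u)"
          using *(2) t0(1) \<beta>(1) by (intro mult_strict_mono) auto
        then show False using \<beta>(2) t0(1) by (simp add: u_def)
      qed
      moreover have "0 \<le> B" by (simp add: B_def)
      ultimately have "kappa \<rho> g H \<le> ereal B"
        unfolding kappa_def by (intro Sup_least) auto
      then show ?thesis using kappa_ge0 by auto
    qed

    \<comment> \<open>Bounds on \<open>tstar\<close>, from one chosen eigenvector\<close>
    obtain w where "norm w = 1" "eigenpair (bordered tstar g H) L w"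
      unfolding L_def using lam_eigenvector[OF H_sym] .
    note w = eigenvector[OF this]
    define x where "x = (1 / head w) *\<^sub>R tail w"
    have x: "(norm x)\<^sup>2 = s" "tstar + g \<bullet> x = L" "g + H *v x = L *\<^sub>R x"
      using w(2-) by (simp_all add: x_def)
    have L_le: "L \<le> lambda_min H" unfolding L_def by (rule lam_le_lambda_min[OF H_sym])

    have upper: "tstar \<le> lambda_min H + \<eta> * norm g" if \<eta>: "tau \<rho> g H \<le> ereal \<eta>" for \<eta>
    proof -
      \<comment> \<open>Comparison with the origin, where the objective is 0, places
        \<open>norm x\<close> in the set defining \<open>tau\<close>; its factor 2 comes from
        \<open>a + b \<le> 2 * max a b\<close>.\<close>
      have "objective \<rho> g H x \<le> objective \<rho> g H 0"
        using objective_le[OF x] objective_ge by (rule order_trans)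
      then have "2 * (g \<bullet> x) + x \<bullet> (H *v x) + p \<le> 0"
        using nonpos_arg[of 0] by (simp add: objective_def x(1) ps)
      moreover have "\<bar>g \<bullet> x\<bar> \<le> norm g * norm x" by (rule Cauchy_Schwarz_ineq2)
      ultimately have "p \<le> 2 * max (2 * norm g * norm x) (spectral_norm H * (norm x)\<^sup>2)"
        using xHx[of x] by linarith
      then have "ereal (norm x) \<le> tau \<rho> g H" by (intro tau_ge) (simp_all add: x(1) ps)
      then have "norm x \<le> \<eta>" using \<eta> by (meson ereal_less_eq(3) order_trans)
      then have "norm x * norm g \<le> \<eta> * norm g" by (rule mult_right_mono) simp
      then show ?thesis using x(2) L_le \<open>\<bar>g \<bullet> x\<bar> \<le> norm g * norm x\<close>
        by (simp add: mult.commute)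
    qed

    have lower: "lambda_min H - \<zeta> \<le> tstar" if \<zeta>: "kappa \<rho> g H \<le> ereal \<zeta>" for \<zeta>
    proof -
      \<comment> \<open>With this \<beta> the argument \<open>\<beta> - lambda_min H\<close> in
        \<open>kappa\<close> equals \<open>- L\<close>, where the conjugate has derivative
        \<open>(norm x)\<^sup>2\<close>. Since \<open>L \<le> tstar\<close>, it remains to show
        \<open>\<beta> \<le> \<zeta>\<close>.\<close>
      define \<beta> where "\<beta> = lambda_min H - L"
      have "x \<bullet> (g + H *v x) = L * (norm x)\<^sup>2" by (simp add: x(3) dot_square_norm)
      then have gx: "\<beta> * (norm x)\<^sup>2 \<le> - (g \<bullet> x)"
        using lambda_min_rayleigh(2)[OF H_sym, of x]
        by (simp add: \<beta>_def dot_square_norm inner_add inner_commute algebra_simps)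
      have "\<beta> \<ge> 0" using L_le by (simp add: \<beta>_def)
      then have "0 \<le> \<beta> * (norm x)\<^sup>2" by simp
      then have "L \<le> tstar" using gx x(2) by linarith
      have "\<beta> \<le> \<zeta>"
      proof (cases "\<beta> = 0")
        \<comment> \<open>The strict inequality in \<open>kappa\<close> excludes
          \<open>\<beta> = 0\<close>; the adjoined element 0 supplies
          \<open>0 \<le> \<zeta>\<close>.\<close>
        case True
        then show ?thesis using kappa_ge0 \<zeta> by (metis ereal_less_eq(5) order_trans)
      next
        case False
        have "\<bar>g \<bullet> x\<bar> \<le> norm g * norm x" by (rule Cauchy_Schwarz_ineq2)
        then have "norm x * (\<beta> * norm x) \<le> norm x * norm g"
          using gx by (simp add: power2_eq_square mult_ac)
        then have "\<beta> * norm x \<le> norm g"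
          by (cases "norm x = 0") (auto simp: mult_le_cancel_left)
        moreover have "ederiv (monotone_conjugate \<rho>) (- L) = (norm x)\<^sup>2"
          using ederiv_conjugate[OF att] conj_diff L_neg by (simp add: x(1))
        ultimately have "\<beta> * sqrt (ederiv (monotone_conjugate \<rho>) (\<beta> - lambda_min H)) \<le> norm g"
          by (simp add: \<beta>_def)
        moreover have "\<beta> > max (lambda_min H) 0"
          using False \<open>\<beta> \<ge> 0\<close> L_neg by (simp add: \<beta>_def)
        ultimately have "ereal \<beta> \<le> kappa \<rho> g H"
          unfolding kappa_def by (intro Sup_upper imageI) simp
        then show ?thesis using \<zeta> by (meson ereal_less_eq(3) order_trans)
      qed
      then show ?thesis using \<open>L \<le> tstar\<close> by (simp add: \<beta>_def)
    qed

    have "ereal tstar \<le> tbar g H"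
      using tbar_ge[OF H_sym L_le _ x(3), of tstar] x(2) by simp
    moreover have "head w \<noteq> 0
        \<and> (\<forall>y. objective \<rho> g H ((1 / head w) *\<^sub>R tail w) \<le> objective \<rho> g H y)"
      if "norm w = 1" "eigenpair (bordered tstar g H) L w" for w
      using eigenvector(1)[OF that] order_trans[OF objective_le[OF eigenvector(2-4)[OF that]] objective_ge]
      by simp
    ultimately show ?thesis
      using L_neg tau_fin kappa_fin upper lower unfolding L_def[symmetric] by simp
  qed
  show ?thesis using tbar_eq_SUP(1)[OF H_sym] tbar_ninf lam_le_0 main by blast
qed

end
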